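(* There is no maximal finitely periodic group with infinitely many orbits. That is, if $G \leq S_\infty$ is a maximal finitely periodic group, then the natural action of $G$ on $\omega$ has only finitely many orbits.
   Context: $\omega$ is the set of natural numbers and $S_\infty$ is the group of all permutations of $\omega$, with identity $\mathrm{id}_\omega$. An element $g \in S_\infty \setminus \{\mathrm{id}_\omega\}$ is called finitely periodic if the cyclic group $\langle g \rangle \leq S_\infty$, acting on $\omega$, has only finitely many finite orbits. A subgroup $G \leq S_\infty$ is called finitely periodic if every $g \in G \setminus \{\mathrm{id}_\omega\}$ is finitely periodic. A maximal finitely periodic group (mpg) is a finitely periodic group that is not strictly contained in any other finitely periodic subgroup of $S_\infty$. The orbits of $G$ are the orbits of its natural action on $\omega$. *)

theory Defs
  imports "HOL-Algebra.Algebra"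
begin

definition Sinf :: "(nat \<Rightarrow> nat) monoid" where
  "Sinf = BijGroup UNIV"

text \<open>On the full type, the extensionality and restriction built into the library's
  group of bijections are vacuous.\<close>

lemma Sinf_simps:
  "carrier Sinf = {f. bij f}"
  "\<one>\<^bsub>Sinf\<^esub> = id"
  "bij f \<Longrightarrow> bij g \<Longrightarrow> f \<otimes>\<^bsub>Sinf\<^esub> g = f \<circ> g"
  by (auto simp: Sinf_def BijGroup_def Bij_def extensional_def compose_def fun_eq_iff)

lemma group_Sinf: "group Sinf"
  by (simp add: Sinf_def group_BijGroup)

definition nat_orbits :: "(nat \<Rightarrow> nat) set \<Rightarrow> nat set set" where
  "nat_orbits H = orbits (Sinf\<lparr>carrier := H\<rparr>) UNIV (\<lambda>g. g)"

lemma natural_action: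
  assumes "subgroup H Sinf"
  shows "group_action (Sinf\<lparr>carrier := H\<rparr>) UNIV (\<lambda>g. g)"
proof -
  have "group (Sinf\<lparr>carrier := H\<rparr>)"
    using assms group_Sinf by (rule subgroup.subgroup_is_group)
  moreover have "(\<lambda>g. g) \<in> hom (Sinf\<lparr>carrier := H\<rparr>) (BijGroup UNIV)"
    using subgroup.subset[OF assms] by (auto simp: hom_def Sinf_def)
  ultimately show ?thesis
    by (simp add: group_action_def group_hom_def group_hom_axioms_def group_BijGroup)
qed

definition finitely_periodic :: "(nat \<Rightarrow> nat) \<Rightarrow> bool" where
  "finitely_periodic g \<longleftrightarrow>
     g \<in> carrier Sinf - {\<one>\<^bsub>Sinf\<^esub>} \<and>
     finite {A \<in> nat_orbits (generate Sinf {g}). finite A}"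

definition finitely_periodic_group :: "(nat \<Rightarrow> nat) set \<Rightarrow> bool" where
  "finitely_periodic_group G \<longleftrightarrow>
     subgroup G Sinf \<and> (\<forall>g \<in> G - {\<one>\<^bsub>Sinf\<^esub>}. finitely_periodic g)"

definition maximal_finitely_periodic_group :: "(nat \<Rightarrow> nat) set \<Rightarrow> bool" where
  "maximal_finitely_periodic_group G \<longleftrightarrow>
     finitely_periodic_group G \<and> (\<nexists>H. finitely_periodic_group H \<and> G \<subset> H)"

end

theory Submission
  imports Defs
begin

text \<open>Suppose \<open>G\<close> has infinitely many orbits. Choose a permutation \<open>h\<close> such that the bipartite
  incidence graph between the orbits of \<open>G\<close> and the orbits of \<open>h\<close> is a forest and all orbits of
  \<open>h\<close> are infinite. An element of \<open>\<langle>G, h\<rangle>\<close> is conjugate to an element of \<open>G\<close> or to a cyclically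
  reduced word \<open>w\<close> that involves \<open>h\<close>. The walk traced by \<open>w\<close> from a point of a finite orbit is
  closed, so in the forest it must backtrack, which is possible only at a fixed point of one of
  the finitely many letters \<open>g \<noteq> id\<close> of \<open>w\<close> from \<open>G\<close>. Each such letter has finitely many fixed
  points, so \<open>w\<close> has finitely many finite orbits, and \<open>G\<close> is not maximal.\<close>

section \<open>Finite orbits and periodic points\<close>

text \<open>For a permutation of the naturals these are the points in finite orbits of the cyclic
  group it generates, so having finitely many finite orbits means that this set is finite.\<close>

definition periodic_points :: "('a \<Rightarrow> 'a) \<Rightarrow> 'a set" where
  "periodic_points u = {x. \<exists>m>0. (u ^^ m) x = x}"

lemma fixed_point_periodic: "u x = x \<Longrightarrow> x \<in> periodic_points u"
  unfolding periodic_points_def by (rule CollectI, rule exI[of _ 1]) simp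

lemma finite_forward_orbit:
  assumes "x \<in> periodic_points u"
  shows "finite (range (\<lambda>j. (u ^^ j) x))"
proof -
  obtain m where m: "m > 0" "(u ^^ m) x = x"
    using assms by (auto simp: periodic_points_def)
  have "range (\<lambda>j. (u ^^ j) x) \<subseteq> (\<lambda>j. (u ^^ j) x) ` {..<m}"
  proof clarify
    fix j
    have "(u ^^ j) x = (u ^^ (j mod m)) x"
      using funpow_mod_eq[OF m(2)] by simp
    then show "(u ^^ j) x \<in> (\<lambda>j. (u ^^ j) x) ` {..<m}"
      using m(1) by (intro image_eqI[of _ _ "j mod m"]) auto
  qed
  then show ?thesis
    by (rule finite_subset) simp
qed

text \<open>Each cycle is recovered by iterating from a point where it meets \<open>F\<close>, so
  finitely many finite cycles cover all periodic points.\<close>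

lemma finite_periodic_points_if_meets_finite:
  assumes "finite F"
    and meets: "\<And>x. x \<in> periodic_points u \<Longrightarrow> \<exists>j. (u ^^ j) x \<in> F"
  shows "finite (periodic_points u)"
proof -
  have "periodic_points u \<subseteq> (\<Union>y\<in>F \<inter> periodic_points u. range (\<lambda>j. (u ^^ j) y))"
  proof
    fix x assume x: "x \<in> periodic_points u"
    then obtain m where m: "m > 0" "(u ^^ m) x = x"
      by (auto simp: periodic_points_def)
    obtain j where j: "(u ^^ j) x \<in> F"
      using meets[OF x] by blast
    have "(u ^^ m) ((u ^^ j) x) = (u ^^ j) x"
      by (metis m(2) add.commute comp_apply funpow_add)
    then have "(u ^^ j) x \<in> periodic_points u"
      using m(1) by (auto simp: periodic_points_def)
    \<comment> \<open>Going on from iterate \<open>j\<close> to iterate \<open>m * j\<close>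
      completes whole periods; \<open>m > 0\<close> keeps the subtraction from truncating.\<close>
    moreover have "x = (u ^^ (m * j - j)) ((u ^^ j) x)"
    proof -
      have "(u ^^ (m * j - j)) ((u ^^ j) x) = (u ^^ (m * j - j + j)) x"
        by (simp add: funpow_add)
      also have "m * j - j + j = m * j"
        using m(1) by simp
      also have "(u ^^ (m * j)) x = x"
        using funpow_mod_eq[OF m(2), of "m * j"] by simp
      finally show ?thesis by simp
    qed
    ultimately show "x \<in> (\<Union>y\<in>F \<inter> periodic_points u. range (\<lambda>j. (u ^^ j) y))"
      using j by blast
  qed
  then show ?thesis
    using assms(1) finite_forward_orbit
    by (elim finite_subset) (intro finite_UN_I, auto)
qed

lemma periodic_points_conjugate:
  assumes "bij c"
  shows "periodic_points (c \<circ> u \<circ> inv' c) = c ` periodic_points u"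
proof -
  have pow: "((c \<circ> u \<circ> inv' c) ^^ m) x = c ((u ^^ m) (inv' c x))" for m x
    using assms by (induction m) (auto simp: bij_is_inj bij_is_surj surj_f_inv_f)
  have "x \<in> periodic_points (c \<circ> u \<circ> inv' c) \<longleftrightarrow> inv' c x \<in> periodic_points u" for x
    unfolding periodic_points_def mem_Collect_eq pow using assms by (metis bij_inv_eq_iff)
  then show ?thesis
    using bij_image_Collect_eq[OF assms, of "\<lambda>x. x \<in> periodic_points u"] by auto
qed

section \<open>Finite orbits of cyclic subgroups of \<open>Sinf\<close>\<close>

lemma inv_Sinf: "bij f \<Longrightarrow> inv\<^bsub>Sinf\<^esub> f = inv' f"
  by (intro group.inv_equality[OF group_Sinf])
    (auto simp: Sinf_simps bij_imp_bij_inv bij_is_inj)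

lemma nat_orbits_eq: "nat_orbits H = range (\<lambda>x. {f x | f. f \<in> H})"
  by (auto simp: nat_orbits_def orbits_def orbit_def)

lemma generate_bij:
  assumes "f \<in> generate Sinf S" "S \<subseteq> {f. bij f}"
  shows "bij f"
  using group.generate_in_carrier[OF group_Sinf, of S f] assms by (auto simp: Sinf_simps)

lemma funpow_in_generate:
  assumes "bij u"
  shows "u ^^ n \<in> generate Sinf {u}"
proof (induction n)
  case 0
  then show ?case
    using generate.one[of Sinf "{u}"] by (simp add: Sinf_simps id_def)
next
  case (Suc n)
  have "u \<otimes>\<^bsub>Sinf\<^esub> (u ^^ n) \<in> generate Sinf {u}"
    by (intro generate.eng generate.incl Suc) simp
  moreover have "u \<otimes>\<^bsub>Sinf\<^esub> (u ^^ n) = u ^^ Suc n"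
    using assms by (simp add: Sinf_simps bij_betw_funpow)
  ultimately show ?case by metis
qed

text \<open>A cycle of \<open>u\<close> is closed under the inverse of \<open>u\<close> too: with
  period \<open>m\<close>, one step back is \<open>m - 1\<close> steps forward.\<close>

lemma generate_forward_orbit:
  assumes "bij u" "x \<in> periodic_points u" "f \<in> generate Sinf {u}"
    and "y \<in> range (\<lambda>j. (u ^^ j) x)"
  shows "f y \<in> range (\<lambda>j. (u ^^ j) x)"
  using assms(3,4)
proof (induction arbitrary: y rule: generate.induct)
  case one
  then show ?case by (simp add: Sinf_simps)
next
  case (incl h)
  then obtain j where "y = (u ^^ j) x" "h = u" by auto
  then have "h y = (u ^^ Suc j) x" by simp
  then show ?case by blast
next
  case (inv h)
  then obtain j where j: "y = (u ^^ j) x" "h = u" by auto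
  obtain m where m: "m > 0" "(u ^^ m) x = x"
    using assms(2) by (auto simp: periodic_points_def)
  have "y = (u ^^ (j + m)) x"
    using m(2) j by (simp add: funpow_add)
  also have "\<dots> = u ((u ^^ (j + m - 1)) x)"
    using m(1) by (cases m) auto
  finally have "inv' u y = (u ^^ (j + m - 1)) x"
    using assms(1) by (simp add: bij_is_inj)
  then show ?case
    using j assms(1) by (auto simp: inv_Sinf)
next
  case (eng h1 h2)
  then have "bij h1" "bij h2"
    using assms(1) by (auto intro: generate_bij)
  then show ?case
    using eng by (simp add: Sinf_simps)
qed

lemma finite_cyclic_orbit_iff:
  assumes "bij u"
  shows "finite {f x | f. f \<in> generate Sinf {u}} \<longleftrightarrow> x \<in> periodic_points u"
proof
  assume fin: "finite {f x | f. f \<in> generate Sinf {u}}"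
  have "range (\<lambda>j. (u ^^ j) x) \<subseteq> {f x | f. f \<in> generate Sinf {u}}"
    using funpow_in_generate[OF assms] by blast
  then have "\<not> inj (\<lambda>j. (u ^^ j) x)"
    using fin finite_subset range_inj_infinite by blast
  then obtain i j where "i < j" and ij: "(u ^^ i) x = (u ^^ j) x"
    using linorder_injI[of "\<lambda>j. (u ^^ j) x"] by blast
  then have "(u ^^ i) ((u ^^ (j - i)) x) = (u ^^ i) x"
    by (metis comp_apply funpow_add le_add_diff_inverse less_imp_le)
  then have "(u ^^ (j - i)) x = x"
    using assms by (metis bij_betw_funpow bij_is_inj injD)
  then show "x \<in> periodic_points u"
    using \<open>i < j\<close> by (auto simp: periodic_points_def intro!: exI[of _ "j - i"])
next
  assume x: "x \<in> periodic_points u"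
  have "x \<in> range (\<lambda>j. (u ^^ j) x)"
    by (rule range_eqI[of _ _ 0]) simp
  then have "{f x | f. f \<in> generate Sinf {u}} \<subseteq> range (\<lambda>j. (u ^^ j) x)"
    using generate_forward_orbit[OF assms x] by blast
  then show "finite {f x | f. f \<in> generate Sinf {u}}"
    using finite_forward_orbit[OF x] finite_subset by blast
qed

text \<open>The finite orbits are the orbits of periodic points and together cover them, so both
  families are finite at once. The identity fails on both sides, as it fixes infinitely many
  points.\<close>

lemma finitely_periodic_iff:
  "finitely_periodic u \<longleftrightarrow> bij u \<and> finite (periodic_points u)"
proof (cases "bij u")
  case True
  let ?orb = "\<lambda>x. {f x | f. f \<in> generate Sinf {u}}"
  have eq: "{A \<in> nat_orbits (generate Sinf {u}). finite A} = ?orb ` periodic_points u"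
    unfolding nat_orbits_eq using finite_cyclic_orbit_iff[OF True] by auto
  have "x \<in> ?orb x" for x
    using generate.one[of Sinf "{u}"] by (auto simp: Sinf_simps intro!: exI[of _ id])
  then have sub: "periodic_points u \<subseteq> \<Union> (?orb ` periodic_points u)"
    by blast
  have fin: "finite (?orb ` periodic_points u) \<longleftrightarrow> finite (periodic_points u)"
  proof
    assume "finite (?orb ` periodic_points u)"
    then have "finite (\<Union> (?orb ` periodic_points u))"
      using finite_cyclic_orbit_iff[OF True] by (intro finite_Union) auto
    then show "finite (periodic_points u)"
      using sub finite_subset by blast
  qed simp
  have "\<not> finite (periodic_points (id :: nat \<Rightarrow> nat))"
  proof -
    have "periodic_points (id :: nat \<Rightarrow> nat) = UNIV"
      using fixed_point_periodic[of id] by auto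
    then show ?thesis by simp
  qed
  then show ?thesis
    unfolding finitely_periodic_def eq fin using True by (auto simp: Sinf_simps)
qed (simp add: finitely_periodic_def Sinf_simps)

section \<open>A permutation whose edges form a forest over the orbits\<close>

text \<open>The permutation is the set of edges \<open>(p True n, p False n)\<close>. Freshness of an end of edge
  \<open>n\<close>, namely that no earlier end lies in its class, makes edge \<open>n\<close> a leaf at the time when it
  is added.\<close>

lemma forest_edges_exist:
  fixes q :: "nat \<Rightarrow> 'b"
  assumes inf: "infinite (range q)"
  obtains p :: "bool \<Rightarrow> nat \<Rightarrow> nat" where
    "\<And>\<delta>. bij (p \<delta>)"
    "\<And>n. \<exists>\<delta>. \<forall>m\<le>n. \<forall>\<delta>'. q (p \<delta>' m) = q (p \<delta> n) \<longrightarrow> m = n \<and> \<delta>' = \<delta>"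
proof -
  define P :: "(nat \<Rightarrow> bool \<Rightarrow> nat) \<Rightarrow> nat \<Rightarrow> (bool \<Rightarrow> nat) \<Rightarrow> bool" where
    "P f n r \<longleftrightarrow> r (even n) = (LEAST x. x \<notin> (\<lambda>m. f m (even n)) ` {..<n}) \<and>
       q (r (odd n)) \<noteq> q (r (even n)) \<and> (\<forall>m<n. \<forall>\<delta>. q (r (odd n)) \<noteq> q (f m \<delta>))" for f n r
  have "\<exists>f. \<forall>n. P f n (f n)"
  proof (rule dependent_wf_choice[OF wf_less_than])
    fix f g :: "nat \<Rightarrow> bool \<Rightarrow> nat" and n r
    assume "\<And>z. (z, n) \<in> less_than \<Longrightarrow> f z = g z"
    then have eq: "f m = g m" if "m < n" for m using that by simp
    then have "(\<lambda>m. f m (even n)) ` {..<n} = (\<lambda>m. g m (even n)) ` {..<n}"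
      by (intro image_cong) auto
    then show "P f n r = P g n r"
      unfolding P_def using eq by auto
  next
    fix n and f :: "nat \<Rightarrow> bool \<Rightarrow> nat"
    define x where "x = (LEAST x. x \<notin> (\<lambda>m. f m (even n)) ` {..<n})"
    have "finite (insert (q x) (\<Union>\<delta>. (\<lambda>m. q (f m \<delta>)) ` {..<n}))"
      by simp
    \<comment> \<open>Only finitely many classes are forbidden, while infinitely many exist.\<close>
    then obtain y where "q y \<notin> insert (q x) (\<Union>\<delta>. (\<lambda>m. q (f m \<delta>)) ` {..<n})"
      using inf by (metis finite_subset image_subsetI)
    then have "P f n (\<lambda>\<delta>. if \<delta> = even n then x else y)"
      unfolding P_def x_def[symmetric] by auto
    then show "\<exists>r. P f n r" by blast
  qed
  then obtain f where f: "\<And>n. P f n (f n)" by blast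
  have least: "f n (even n) = (LEAST x. x \<notin> (\<lambda>m. f m (even n)) ` {..<n})" for n
    using f[of n] by (simp only: P_def)
  have fresh_same: "q (f n (odd n)) \<noteq> q (f n (even n))" for n
    using f[of n] unfolding P_def by blast
  have fresh_less: "q (f n (odd n)) \<noteq> q (f m \<delta>)" if "m < n" for m n \<delta>
    using f[of n] that unfolding P_def by blast
  have least_new: "f n (even n) \<noteq> f m (even n)" if "m < n" for m n
  proof -
    have "\<exists>x. x \<notin> (\<lambda>m. f m (even n)) ` {..<n}"
      by (rule ex_new_if_finite) auto
    then have "f n (even n) \<notin> (\<lambda>m. f m (even n)) ` {..<n}"
      unfolding least by (rule LeastI_ex)
    then show ?thesis using that by blast
  qed
  have neq: "f m \<delta> \<noteq> f n \<delta>" if "m < n" for m n \<delta>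
  proof (cases "\<delta> = even n")
    case True
    show ?thesis unfolding True using least_new[OF that] by (rule not_sym)
  next
    case False
    then have \<delta>: "\<delta> = odd n" by blast
    show ?thesis
      unfolding \<delta> using fresh_less[OF that, of "odd n"] by (rule contrapos_nn) (rule arg_cong, rule sym)
  qed
  have inj: "inj (\<lambda>n. f n \<delta>)" for \<delta>
    by (rule linorder_injI) (rule neq)
  have surj: "surj (\<lambda>n. f n \<delta>)" for \<delta>
  proof (rule ccontr)
    assume "\<not> surj (\<lambda>n. f n \<delta>)"
    then obtain z where z: "\<And>n. f n \<delta> \<noteq> z" by (auto simp: surj_def) metis
    define k where "k i = 2 * i + (if \<delta> then 0 else 1)" for i :: nat
    have "f (k i) \<delta> \<le> z" for i
    proof -
      have "even (k i) = \<delta>" by (simp add: k_def)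
      then have "f (k i) \<delta> = (LEAST x. x \<notin> (\<lambda>m. f m \<delta>) ` {..<k i})"
        using least[of "k i"] by simp
      also have "\<dots> \<le> z"
        using z by (intro Least_le) auto
      finally show ?thesis .
    qed
    then have "range (\<lambda>i. f (k i) \<delta>) \<subseteq> {..z}" by auto
    moreover have "inj (\<lambda>i. f (k i) \<delta>)"
    proof (rule injI)
      fix i j assume "f (k i) \<delta> = f (k j) \<delta>"
      then have "k i = k j" using injD[OF inj[of \<delta>]] by blast
      then show "i = j" by (simp add: k_def)
    qed
    ultimately show False
      using finite_subset range_inj_infinite finite_atMost by metis
  qed
  show thesis
  proof (rule that[of "\<lambda>\<delta> n. f n \<delta>"])
    show "bij (\<lambda>n. f n \<delta>)" for \<delta>
      using inj surj by (simp add: bij_def)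
    fix n
    have "m = n \<and> \<delta>' = odd n" if "m \<le> n" "q (f m \<delta>') = q (f n (odd n))" for m \<delta>'
    proof (cases "m < n")
      case True
      then show ?thesis using fresh_less[of m n \<delta>'] that(2) by metis
    next
      case False
      then have "m = n" using that by simp
      moreover have "\<delta>' \<noteq> even n"
      proof
        assume "\<delta>' = even n"
        then have "q (f n (even n)) = q (f n (odd n))"
          using that(2) \<open>m = n\<close> by (simp only:)
        then show False using fresh_same[of n] by (rule notE[rotated, OF sym])
      qed
      ultimately show ?thesis by blast
    qed
    then show "\<exists>\<delta>. \<forall>m\<le>n. \<forall>\<delta>'. q (f m \<delta>') = q (f n \<delta>) \<longrightarrow> m = n \<and> \<delta>' = \<delta>"
      by blast
  qed
qed

text \<open>The edge of largest index on a closed walk is traversed back immediately, at its fresh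
  end.\<close>

lemma closed_walk_backtracks:
  fixes p :: "bool \<Rightarrow> nat \<Rightarrow> 'a" and q :: "'a \<Rightarrow> 'b"
  assumes fresh: "\<And>n. \<exists>\<delta>. \<forall>m\<le>n. \<forall>\<delta>'. q (p \<delta>' m) = q (p \<delta> n) \<longrightarrow> m = n \<and> \<delta>' = \<delta>"
    and walk: "\<And>i. q (p (d (Suc i)) (e (Suc i))) = q (p (\<not> d i) (e i))"
    and closed: "N > 0" "\<And>i. e (i + N) = e i"
  obtains i where "e (Suc i) = e i" "d (Suc i) \<noteq> d i"
proof -
  \<comment> \<open>Step \<open>i\<close> enters edge \<open>e i\<close> at its end
    \<open>d i\<close> and leaves at the other end. By periodicity finitely many edges occur, so a
    largest index exists.\<close>
  have "e i = e (i mod N)" for i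
  proof (induction i rule: less_induct)
    case (less i)
    show ?case
    proof (cases "i < N")
      case False
      then show ?thesis
        using less[of "i - N"] closed(2)[of "i - N"] closed(1) by (simp add: le_mod_geq)
    qed simp
  qed
  then have "range e \<subseteq> e ` {..<N}"
    using closed(1) by (metis image_subsetI imageI lessThan_iff mod_less_divisor)
  then have fin: "finite (range e)"
    by (rule finite_subset) simp
  then have "Max (range e) \<in> range e"
    by (intro Max_in) auto
  then obtain i0 where "e i0 = Max (range e)" by auto
  \<comment> \<open>Shifting by the period gives the maximal edge a predecessor on the walk.\<close>
  then have "e (i0 + N) = Max (range e)" using closed(2) by simp
  then obtain i where i: "e (Suc i) = Max (range e)"
    using closed(1) by (cases "i0 + N") auto
  have le: "e j \<le> e (Suc i)" for j
    using fin i by simp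
  obtain \<delta> where \<delta>: "\<And>m \<delta>'. m \<le> e (Suc i) \<Longrightarrow> q (p \<delta>' m) = q (p \<delta> (e (Suc i)))
      \<Longrightarrow> m = e (Suc i) \<and> \<delta>' = \<delta>"
    using fresh by metis
  \<comment> \<open>If the walk enters the maximal edge at its fresh end, the step before used the
    same edge; if it leaves there, the step after does.\<close>
  show thesis
  proof (cases "\<delta> = d (Suc i)")
    case True
    then have "e i = e (Suc i) \<and> (\<not> d i) = \<delta>"
      using \<delta>[OF le, of "\<not> d i" i] walk[of i] by auto
    then show thesis
      using that[of i] True by auto
  next
    case False
    then have "\<delta> = (\<not> d (Suc i))" by auto
    then have "q (p (d (Suc (Suc i))) (e (Suc (Suc i)))) = q (p \<delta> (e (Suc i)))"
      using walk[of "Suc i"] by simp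
    then have "e (Suc (Suc i)) = e (Suc i) \<and> d (Suc (Suc i)) = \<delta>"
      using \<delta>[OF le] by blast
    then show thesis
      using that[of "Suc i"] False by auto
  qed
qed

section \<open>Adjoining the permutation\<close>

text \<open>\<open>q\<close> will be the orbit map of \<open>G\<close>; \<open>p True n\<close> and
  \<open>p False n\<close> are the ends of edge \<open>n\<close> of the forest.\<close>

locale forest_extension =
  fixes G :: "(nat \<Rightarrow> nat) set" and q :: "nat \<Rightarrow> 'b" and p :: "bool \<Rightarrow> nat \<Rightarrow> nat"
  assumes fpg: "finitely_periodic_group G"
    and q_invariant: "g \<in> G \<Longrightarrow> q (g x) = q x"
    and bij_p: "bij (p \<delta>)"
    and fresh: "\<exists>\<delta>. \<forall>m\<le>n. \<forall>\<delta>'. q (p \<delta>' m) = q (p \<delta> n) \<longrightarrow> m = n \<and> \<delta>' = \<delta>"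
begin

lemma subgroup_G: "subgroup G Sinf"
  using fpg by (simp add: finitely_periodic_group_def)

lemma bij_G: "g \<in> G \<Longrightarrow> bij g"
  using subgroup.subset[OF subgroup_G] by (auto simp: Sinf_simps)

lemma id_G: "id \<in> G"
  using subgroup.one_closed[OF subgroup_G] by (simp add: Sinf_simps)

lemma comp_G: "g \<in> G \<Longrightarrow> g' \<in> G \<Longrightarrow> g \<circ> g' \<in> G"
  using subgroup.m_closed[OF subgroup_G, of g g'] by (simp add: Sinf_simps bij_G)

lemma finite_periodic_points_G: "g \<in> G \<Longrightarrow> g \<noteq> id \<Longrightarrow> finite (periodic_points g)"
  using fpg by (simp add: finitely_periodic_group_def finitely_periodic_iff Sinf_simps)

text \<open>\<open>hop True\<close> is the new permutation and \<open>hop False\<close> is its inverse.\<close>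

definition hop :: "bool \<Rightarrow> nat \<Rightarrow> nat" where
  "hop \<delta> = p (\<not> \<delta>) \<circ> inv' (p \<delta>)"

lemma bij_hop: "bij (hop \<delta>)"
  unfolding hop_def by (intro bij_comp bij_imp_bij_inv bij_p)

lemma hop_hop: "hop (\<not> \<delta>) \<circ> hop \<delta> = id"
  by (auto simp: hop_def fun_eq_iff bij_is_inj[OF bij_p] surj_f_inv_f[OF bij_is_surj[OF bij_p]])

lemma inv_hop: "inv' (hop \<delta>) = hop (\<not> \<delta>)"
  using hop_hop[of \<delta>] hop_hop[of "\<not> \<delta>"] by (intro inv_unique_comp) auto

text \<open>The head of the list acts first: it crosses an edge from its end \<open>fst a\<close>
  and then applies \<open>snd a\<close>, which for \<open>letters\<close> stays inside a class.
  Prefixes are thus initial segments of a walk.\<close>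

primrec word :: "(bool \<times> (nat \<Rightarrow> nat)) list \<Rightarrow> nat \<Rightarrow> nat" where
  "word [] = id"
| "word (a # l) = word l \<circ> (snd a \<circ> hop (fst a))"

definition letters :: "(bool \<times> (nat \<Rightarrow> nat)) set" where
  "letters = UNIV \<times> G"

text \<open>Cyclic reducedness as in the free product of \<open>G\<close> with an infinite cyclic
  group. Powers of the hop are spelled with letters \<open>id\<close>; excluded is a hop undone by
  the next one, also across the end of the word.\<close>

definition cyclically_reduced :: "(bool \<times> (nat \<Rightarrow> nat)) list \<Rightarrow> bool" where
  "cyclically_reduced l \<longleftrightarrow> (\<forall>i<length l.
     fst (l ! (Suc i mod length l)) \<noteq> fst (l ! i) \<longrightarrow> snd (l ! i) \<noteq> id)"

lemma word_append: "word (l @ l') = word l' \<circ> word l"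
  by (induction l) (simp_all add: comp_assoc)

lemma bij_word: "set l \<subseteq> letters \<Longrightarrow> bij (word l)"
  by (induction l) (auto simp: letters_def bij_G bij_hop intro!: bij_comp)

text \<open>The last entry acts last, so \<open>g\<close> merges with its component from
  \<open>G\<close>.\<close>

lemma word_absorb:
  assumes "set l \<subseteq> letters" "l \<noteq> []" "g \<in> G"
  obtains l' where "set l' \<subseteq> letters" "length l' = length l" "word l' = g \<circ> word l"
proof -
  obtain r \<delta> g' where l: "l = r @ [(\<delta>, g')]"
    using assms(2) by (metis rev_exhaust surj_pair)
  have "set (r @ [(\<delta>, g \<circ> g')]) \<subseteq> letters"
    using assms l by (auto simp: letters_def intro: comp_G)
  moreover have "word (r @ [(\<delta>, g \<circ> g')]) = g \<circ> word l"
    by (simp add: l word_append comp_assoc)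
  ultimately show thesis
    using that[of "r @ [(\<delta>, g \<circ> g')]"] l by simp
qed

text \<open>\<open>s n\<close> is the point reached from \<open>x\<close> after \<open>n\<close>
  letters of \<open>l\<close> read cyclically. The second equation keeps the whole prefix even where
  a pass ends, so the start of that pass stays visible.\<close>

lemma walk_step:
  fixes l x
  defines "s \<equiv> \<lambda>n. word (take (n mod length l) l) ((word l ^^ (n div length l)) x)"
  assumes "l \<noteq> []"
  shows "s (Suc n) = snd (l ! (n mod length l)) (hop (fst (l ! (n mod length l))) (s n))"
    and "s (Suc n) = word (take (Suc (n mod length l)) l) ((word l ^^ (n div length l)) x)"
proof -
  let ?k = "length l" and ?r = "n mod length l"
  have r: "?r < ?k" using assms by simp
  show *: "s (Suc n) = word (take (Suc ?r) l) ((word l ^^ (n div ?k)) x)"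
  proof (cases "Suc ?r = ?k")
    case True
    then have "Suc n mod ?k = 0" "Suc n div ?k = Suc (n div ?k)"
      by (simp_all add: mod_Suc div_Suc)
    then show ?thesis using True by (simp add: s_def)
  next
    case False
    then have "Suc n mod ?k = Suc ?r" "Suc n div ?k = n div ?k"
      by (simp_all add: mod_Suc div_Suc)
    then show ?thesis by (simp add: s_def)
  qed
  have "take (Suc ?r) l = take ?r l @ [l ! ?r]"
    using r by (rule take_Suc_conv_app_nth)
  then show "s (Suc n) = snd (l ! ?r) (hop (fst (l ! ?r)) (s n))"
    unfolding * by (cases "l ! ?r") (simp add: word_append s_def)
qed

lemma finite_periodic_points_reduced_word:
  assumes l: "set l \<subseteq> letters" "l \<noteq> []" and red: "cyclically_reduced l"
  shows "finite (periodic_points (word l))"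
proof -
  let ?k = "length l"
  \<comment> \<open>Starting points of a pass that reach, after letter \<open>i\<close>, a periodic
    point of its nontrivial component: a finite union of preimages of finite sets under
    injections.\<close>
  define F where "F = (\<Union>i\<in>{i. i < ?k \<and> snd (l ! i) \<noteq> id}.
    word (take (Suc i) l) -` periodic_points (snd (l ! i)))"
  have G: "snd (l ! i) \<in> G" if "i < ?k" for i
    using l(1) nth_mem[OF that] by (auto simp: letters_def mem_Times_iff)
  show ?thesis
  proof (rule finite_periodic_points_if_meets_finite)
    have "inj (word (take i l))" for i
      using l(1) set_take_subset[of i l] by (intro bij_is_inj bij_word) auto
    then show "finite F"
      unfolding F_def by (intro finite_UN_I finite_vimageI finite_periodic_points_G G) auto
  next
    fix x assume "x \<in> periodic_points (word l)"
    then obtain m where m: "m > 0" "(word l ^^ m) x = x"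
      by (auto simp: periodic_points_def)
    \<comment> \<open>\<open>s n\<close> is the point before step \<open>n\<close>, which crosses
      edge \<open>e n\<close> from its end \<open>d n\<close>.\<close>
    define s where "s n = word (take (n mod ?k) l) ((word l ^^ (n div ?k)) x)" for n
    define d where "d n = fst (l ! (n mod ?k))" for n
    define e where "e n = inv' (p (d n)) (s n)" for n
    have s: "s n = p (d n) (e n)" for n
      by (simp add: e_def surj_f_inv_f[OF bij_is_surj[OF bij_p]])
    have hop_s: "hop (d n) (s n) = p (\<not> d n) (e n)" for n
      by (simp add: hop_def e_def)
    note step = walk_step[OF l(2), of _ x, folded s_def d_def]
    have mod_less: "n mod ?k < ?k" for n
      using l(2) by simp
    obtain i where i: "e (Suc i) = e i" "d (Suc i) \<noteq> d i"
    proof (rule closed_walk_backtracks[where q = q and p = p and e = e and d = d])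
      show "\<exists>\<delta>. \<forall>m\<le>n. \<forall>\<delta>'. q (p \<delta>' m) = q (p \<delta> n) \<longrightarrow> m = n \<and> \<delta>' = \<delta>" for n
        by (rule fresh)
      show "q (p (d (Suc i)) (e (Suc i))) = q (p (\<not> d i) (e i))" for i
        using step(1)[of i] q_invariant[OF G[OF mod_less]] by (simp add: s[symmetric] hop_s)
      show "0 < m * ?k"
        using m(1) l(2) by simp
      have "(word l ^^ (i div ?k + m)) x = (word l ^^ (i div ?k)) x" for i
        using m(2) by (simp add: funpow_add)
      then show "e (i + m * ?k) = e i" for i
        using l(2) by (simp add: e_def s_def d_def add.commute)
    qed
    let ?r = "i mod ?k"
    have "fst (l ! (Suc ?r mod ?k)) \<noteq> fst (l ! ?r)"
      using i(2) by (simp add: d_def mod_Suc_eq)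
    then have neq: "snd (l ! ?r) \<noteq> id"
      using red mod_less[of i] unfolding cyclically_reduced_def by blast
    \<comment> \<open>The edge is re-entered at the end just left, so the element of
      \<open>G\<close> between the two hops fixes that point.\<close>
    have "d (Suc i) = (\<not> d i)"
      using i(2) by auto
    then have "hop (d i) (s i) = s (Suc i)"
      using i(1) s[of "Suc i"] hop_s[of i] by simp
    then have "snd (l ! ?r) (s (Suc i)) = s (Suc i)"
      using step(1)[of i] by simp
    then have "s (Suc i) \<in> periodic_points (snd (l ! ?r))"
      by (rule fixed_point_periodic)
    then have "(word l ^^ (i div ?k)) x \<in> F"
      unfolding F_def using step(2)[of i] neq mod_less[of i] by auto
    then show "\<exists>j. (word l ^^ j) x \<in> F" by blast
  qed
qed

section \<open>Cyclic reduction of words\<close>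

lemma finite_periodic_points_rotate:
  assumes "set l \<subseteq> letters" "finite (periodic_points (word (rotate n l)))"
  shows "finite (periodic_points (word l))"
proof -
  define r where "r = n mod length l"
  have rot: "rotate n l = drop r l @ take r l"
    by (simp add: rotate_drop_take r_def)
  have bij: "bij (word (take r l))"
    using assms(1) set_take_subset[of r l] by (intro bij_word) auto
  \<comment> \<open>Moving a prefix to the end of the list conjugates the permutation by the word of
    that prefix.\<close>
  have "word l = word (drop r l) \<circ> word (take r l)"
    by (metis append_take_drop_id word_append)
  then have "word (rotate n l) = word (take r l) \<circ> word l \<circ> inv' (word (take r l))"
    unfolding rot word_append using bij
    by (simp add: fun_eq_iff surj_f_inv_f[OF bij_is_surj[OF bij]])
  then show ?thesis
    using assms(2) periodic_points_conjugate[OF bij, of "word l"] bij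
    by (metis bij_is_inj finite_imageD inj_on_subset top_greatest)
qed

text \<open>Induction on length: in a word that is not reduced, two opposite hops cancel after a
  rotation, and the element of \<open>G\<close> left over is absorbed by the remaining word or is
  all that remains.\<close>

lemma finite_periodic_points_word:
  assumes "set l \<subseteq> letters" "word l \<noteq> id"
  shows "finite (periodic_points (word l))"
  using assms
proof (induction "length l" arbitrary: l rule: less_induct)
  case less
  let ?k = "length l"
  have "l \<noteq> []" using less.prems(2) by auto
  show ?case
  proof (cases "cyclically_reduced l")
    case True
    then show ?thesis
      using finite_periodic_points_reduced_word less.prems(1) \<open>l \<noteq> []\<close> by blast
  next
    case False
    then obtain i where i: "i < ?k" "fst (l ! (Suc i mod ?k)) \<noteq> fst (l ! i)" "snd (l ! i) = id"
      by (auto simp: cyclically_reduced_def)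
    \<comment> \<open>The letter of a one-letter word is its own cyclic successor, so the directions
      could not differ.\<close>
    have k: "?k \<ge> 2"
    proof (rule ccontr)
      assume "\<not> ?k \<ge> 2"
      then have "?k = 1" using i(1) by linarith
      then show False using i(1,2) by simp
    qed
    \<comment> \<open>Rotating by \<open>i + 2\<close> brings the cancelling letters
      \<open>i\<close> and \<open>Suc i mod ?k\<close> to the end of the list, where they amount to
      \<open>g\<close> alone.\<close>
    obtain r \<delta> g where rot: "rotate (i + 2) l = r @ [(\<delta>, id), (\<not> \<delta>, g)]"
    proof -
      let ?l = "rotate (i + 2) l"
      have nth: "?l ! j = l ! ((i + 2 + j) mod ?k)" if "j < ?k" for j
        using nth_rotate[of j l "i + 2"] that by (simp add: add.commute)
      have "i + 2 + (?k - 2) = i + ?k" "i + 2 + (?k - 1) = Suc i + ?k"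
        using k by linarith+
      then have "?l ! (?k - 2) = l ! i" "?l ! (?k - 1) = l ! (Suc i mod ?k)"
        using nth[of "?k - 2"] nth[of "?k - 1"] k i(1) by (simp_all only: mod_add_self2) auto
      moreover obtain r a b where r: "?l = r @ [a, b]"
      proof -
        have ne: "?l \<noteq> []" "butlast ?l \<noteq> []"
          using k by (auto simp flip: length_0_conv)
        have "(butlast (butlast ?l) @ [last (butlast ?l)]) @ [last ?l] = ?l"
          by (simp only: append_butlast_last_id[OF ne(1)] append_butlast_last_id[OF ne(2)])
        then have "?l = butlast (butlast ?l) @ [last (butlast ?l), last ?l]"
          by (simp only: append_assoc append_Cons append_Nil)
        then show thesis by (rule that)
      qed
      moreover have "?k = length r + 2"
        using arg_cong[OF r, of length] by simp
      ultimately have "?l = r @ [l ! i, l ! (Suc i mod ?k)]"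
        by (simp add: nth_append)
      also have "l ! i = (fst (l ! i), id)"
        using i(3) by (simp add: prod_eq_iff)
      also have "l ! (Suc i mod ?k) = (\<not> fst (l ! i), snd (l ! (Suc i mod ?k)))"
        using i(2) by (simp add: prod_eq_iff)
      finally show thesis by (rule that)
    qed
    have "set (r @ [(\<delta>, id), (\<not> \<delta>, g)]) \<subseteq> letters"
      using less.prems(1) set_rotate[of "i + 2" l] rot by metis
    then have r: "set r \<subseteq> letters" and g: "g \<in> G"
      by (auto simp: letters_def)
    have len: "length r < ?k"
      using arg_cong[OF rot, of length] by simp
    have w: "word (rotate (i + 2) l) = g \<circ> word r"
      using hop_hop[of \<delta>] unfolding rot word_append by (simp add: fun_eq_iff)
    have "finite (periodic_points (word (rotate (i + 2) l)))"
      if ne: "word (rotate (i + 2) l) \<noteq> id"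
    proof (cases "r = []")
      case True
      then show ?thesis
        using w ne g finite_periodic_points_G by simp
    next
      case False
      obtain l' where l': "set l' \<subseteq> letters" "length l' = length r" "word l' = g \<circ> word r"
        using word_absorb[OF r False g] .
      then show ?thesis
        using less.hyps[of l'] len w ne by simp
    qed
    \<comment> \<open>For bijections a one-sided inverse is two-sided, so the two blocks may be
      swapped back.\<close>
    moreover have "word (rotate (i + 2) l) \<noteq> id"
    proof
      define n where "n = (i + 2) mod ?k"
      assume "word (rotate (i + 2) l) = id"
      then have "word (take n l) \<circ> word (drop n l) = id"
        by (simp only: rotate_drop_take word_append n_def)
      moreover have "bij (word (take n l))"
        using less.prems(1) set_take_subset[of n l] by (intro bij_word) auto
      ultimately have "word (drop n l) \<circ> word (take n l) = id"
        by (metis bij_is_surj comp_assoc comp_id id_comp inv_o_cancel surj_iff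
            bij_is_inj)
      then have "word l = id"
        by (metis append_take_drop_id word_append)
      then show False
        using less.prems(2) by simp
    qed
    ultimately show ?thesis
      using finite_periodic_points_rotate[OF less.prems(1)] by blast
  qed
qed

section \<open>The enlarged group\<close>

definition extension :: "(nat \<Rightarrow> nat) set" where
  "extension = generate Sinf (insert (hop True) G)"

text \<open>Every letter begins with a hop, so an element of \<open>G\<close> acting first must be
  kept apart as \<open>g\<close>. In a product, the inner \<open>g1\<close> is absorbed by the word
  to its right or merges with \<open>g2\<close>.\<close>

lemma extension_normal_form:
  assumes "w \<in> extension"
  shows "\<exists>l g. set l \<subseteq> letters \<and> g \<in> G \<and> w = word l \<circ> g"
proof -
  have single: "set [(\<delta>, id)] \<subseteq> letters" "hop \<delta> = word [(\<delta>, id)] \<circ> id" for \<delta>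
    using id_G by (auto simp: letters_def)
  show ?thesis
    using assms unfolding extension_def
  proof (induction rule: generate.induct)
    case one
    have "\<one>\<^bsub>Sinf\<^esub> = word [] \<circ> id"
      by (simp add: Sinf_simps)
    then show ?case
      using id_G by (metis empty_subsetI list.set(1))
  next
    case (incl h)
    then show ?case
    proof
      assume "h = hop True"
      then show ?thesis
        using single[of True] id_G by metis
    next
      assume "h \<in> G"
      then show ?thesis by (intro exI[of _ "[]"] exI[of _ h]) simp
    qed
  next
    case (inv h)
    then show ?case
    proof
      assume "h = hop True"
      then show ?thesis
        using single[of False] id_G inv_Sinf[OF bij_hop] inv_hop by metis
    next
      assume "h \<in> G"
      then show ?thesis
        using subgroup.m_inv_closed[OF subgroup_G]
        by (intro exI[of _ "[]"] exI[of _ "inv\<^bsub>Sinf\<^esub> h"]) simp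
    qed
  next
    case (eng h1 h2)
    then obtain l1 g1 l2 g2 where
      1: "set l1 \<subseteq> letters" "g1 \<in> G" "h1 = word l1 \<circ> g1" and
      2: "set l2 \<subseteq> letters" "g2 \<in> G" "h2 = word l2 \<circ> g2" by blast
    have prod: "h1 \<otimes>\<^bsub>Sinf\<^esub> h2 = word l1 \<circ> (g1 \<circ> word l2) \<circ> g2"
      using 1 2 by (simp add: Sinf_simps bij_comp bij_word bij_G comp_assoc)
    show ?case
    proof (cases "l2 = []")
      case True
      then have "h1 \<otimes>\<^bsub>Sinf\<^esub> h2 = word l1 \<circ> (g1 \<circ> g2)"
        using prod by (simp add: comp_assoc)
      then show ?thesis
        using 1 2 comp_G by blast
    next
      case False
      obtain l where "set l \<subseteq> letters" "length l = length l2" "word l = g1 \<circ> word l2"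
        using word_absorb[OF 2(1) False 1(2)] .
      \<comment> \<open>Lists act from the head, so the word of the right factor comes
        first.\<close>
      then show ?thesis
        using 1 2 prod by (intro exI[of _ "l @ l1"] exI[of _ g2]) (simp add: word_append)
    qed
  qed
qed

text \<open>Conjugation by \<open>g\<close> moves it from the first place to the last, where a
  nonempty word absorbs it.\<close>

lemma finite_periodic_points_extension:
  assumes "w \<in> extension" "w \<noteq> id"
  shows "finite (periodic_points w)"
proof -
  obtain l g where lg: "set l \<subseteq> letters" "g \<in> G" "w = word l \<circ> g"
    using extension_normal_form[OF assms(1)] by blast
  show ?thesis
  proof (cases "l = []")
    case True
    then show ?thesis
      using lg assms(2) finite_periodic_points_G by simp
  next
    case False
    obtain l' where l': "set l' \<subseteq> letters" "length l' = length l" "word l' = g \<circ> word l"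
      using word_absorb[OF lg(1) False lg(2)] .
    have g: "bij g" using lg(2) by (rule bij_G)
    have conj: "word l' = g \<circ> w \<circ> inv' g"
      using lg(3) l'(3) by (simp add: fun_eq_iff surj_f_inv_f[OF bij_is_surj[OF g]])
    have "word l' \<noteq> id"
    proof
      assume "word l' = id"
      then have "g (w x) = g x" for x
        using fun_cong[OF conj, of "g x"] g by (simp add: bij_is_inj)
      then show False
        using assms(2) g by (metis bij_is_inj eq_id_iff injD)
    qed
    then have "finite (g ` periodic_points w)"
      using finite_periodic_points_word[OF l'(1)] periodic_points_conjugate[OF g, of w] conj
      by simp
    then show ?thesis
      using g by (metis bij_is_inj finite_imageD inj_on_subset top_greatest)
  qed
qed

lemma finitely_periodic_group_extension: "finitely_periodic_group extension"
proof -
  have sub: "insert (hop True) G \<subseteq> carrier Sinf"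
    using bij_hop bij_G by (auto simp: Sinf_simps)
  have "subgroup extension Sinf"
    unfolding extension_def using group.generate_is_subgroup[OF group_Sinf sub] .
  moreover have "bij w" if "w \<in> extension" for w
    using subgroup.subset[OF calculation] that by (auto simp: Sinf_simps)
  ultimately show ?thesis
    using finite_periodic_points_extension
    by (simp add: finitely_periodic_group_def finitely_periodic_iff Sinf_simps)
qed

text \<open>Freshness of edge 0 puts its two ends in different classes; \<open>hop True\<close>
  joins them, whereas \<open>G\<close> preserves classes.\<close>

lemma G_psubset_extension: "G \<subset> extension"
proof -
  obtain \<delta> where \<delta>: "\<forall>m\<le>0. \<forall>\<delta>'. q (p \<delta>' m) = q (p \<delta> 0) \<longrightarrow> m = 0 \<and> \<delta>' = \<delta>"
    using fresh[of 0] ..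
  have "q (p (\<not> \<delta>) 0) \<noteq> q (p \<delta> 0)"
    using spec[OF mp[OF spec[OF \<delta>, of 0]], of "\<not> \<delta>"] by simp
  then have "q (p False 0) \<noteq> q (p True 0)"
    by (cases \<delta>) auto
  then have "hop True \<notin> G"
    using q_invariant[of "hop True" "p True 0"] bij_is_inj[OF bij_p] by (auto simp: hop_def)
  then show ?thesis
    unfolding extension_def by (auto intro: generate.incl)
qed

end

section \<open>Orbits of \<open>G\<close> and the contradiction with maximality\<close>

lemma orbit_invariant:
  assumes "subgroup G Sinf" "g \<in> G"
  shows "{f (g x) | f. f \<in> G} = {f x | f. f \<in> G}"
proof -
  have bij: "bij f" if "f \<in> G" for f
    using subgroup.subset[OF assms(1)] that by (auto simp: Sinf_simps)
  have comp: "f \<circ> f' \<in> G" if "f \<in> G" "f' \<in> G" for f f'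
    using subgroup.m_closed[OF assms(1) that] bij that by (simp add: Sinf_simps)
  have inv: "inv' g \<in> G"
    using subgroup.m_inv_closed[OF assms] bij[OF assms(2)] by (simp add: inv_Sinf)
  show ?thesis
  proof (intro equalityI subsetI)
    fix y assume "y \<in> {f (g x) | f. f \<in> G}"
    then obtain f where "f \<in> G" "y = (f \<circ> g) x" by auto
    then show "y \<in> {f x | f. f \<in> G}" using comp assms(2) by blast
  next
    fix y assume "y \<in> {f x | f. f \<in> G}"
    then obtain f where "f \<in> G" "y = (f \<circ> inv' g) (g x)"
      using bij[OF assms(2)] by (auto simp: bij_is_inj)
    then show "y \<in> {f (g x) | f. f \<in> G}" using comp inv by blast
  qed
qed

theorem theorem4p6:
  fixes G :: "(nat \<Rightarrow> nat) set"
  assumes "maximal_finitely_periodic_group G"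
  shows "finite (nat_orbits G)"
proof (rule ccontr)
  define q where "q x = {f x | f. f \<in> G}" for x
  assume "infinite (nat_orbits G)"
  then have "infinite (range q)"
    by (simp add: nat_orbits_eq q_def)
  then obtain p :: "bool \<Rightarrow> nat \<Rightarrow> nat" where p: "\<And>\<delta>. bij (p \<delta>)"
    "\<And>n. \<exists>\<delta>. \<forall>m\<le>n. \<forall>\<delta>'. q (p \<delta>' m) = q (p \<delta> n) \<longrightarrow> m = n \<and> \<delta>' = \<delta>"
    by (rule forest_edges_exist) (rule that)
  have fpg: "finitely_periodic_group G"
    using assms by (simp add: maximal_finitely_periodic_group_def)
  then have "q (g x) = q x" if "g \<in> G" for g x
    unfolding q_def using that by (intro orbit_invariant) (simp_all add: finitely_periodic_group_def)
  then interpret forest_extension G q p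
    using fpg p by unfold_locales
  show False
    using assms finitely_periodic_group_extension G_psubset_extension
    by (auto simp: maximal_finitely_periodic_group_def)
qed

end
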